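(* Let $n\ge 2$, $-\infty<\alpha<\beta$, $\beta\in(1/2,1]$ and $0\le p<2$. Let $f$ be a locally integrable complex-valued function on $\mathbb{R}^n$. Suppose there exist positive constants $B$, $C$ and $c$ such that, for all cubes $I\subset\mathbb{R}^n$ and any $t>0$, $$(l(I))^{4\beta-4}\sum_{k=0}^{\infty}2^{(2(\alpha-\beta+1)-n)k}\sum_{J\in\mathcal{D}_k(I)}\frac{m_J(t)}{|J|}\le B\max\left\{1,\left(\frac{C}{t}\right)^{p}\right\}\exp(-ct).$$ Then $f\in Q_\alpha^\beta(\mathbb{R}^n)$.
   Context: All cubes in $\mathbb{R}^n$ have edges parallel to the coordinate axes; $l(I)$ denotes the edge length of a cube $I$ and $|E|$ the Lebesgue measure of a set $E$. For $\alpha\in(-\infty,\beta)$ and $\beta\in(1/2,1]$, $Q_\alpha^\beta(\mathbb{R}^n)$ is the set of all measurable complex-valued functions $f$ on $\mathbb{R}^n$ with $$\|f\|_{Q_\alpha^\beta(\mathbb{R}^n)}=\sup_I\left((l(I))^{2(\alpha+\beta-1)-n}\int_I\int_I\frac{|f(x)-f(y)|^2}{|x-y|^{n+2(\alpha-\beta+1)}}\,dx\,dy\right)^{1/2}<\infty,$$ the supremum being over all cubes $I$ in $\mathbb{R}^n$. For a cube $I$ and an integer $k\ge 0$, $\mathcal{D}_k(I)$ denotes the set of the $2^{kn}$ subcubes of $I$ of edge length $2^{-k}l(I)$ obtained by $k$ successive bipartitions of each edge of $I$. For a cube $J$, $f(J)=\frac{1}{|J|}\int_J f(x)\,dx$,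 and $m_J(t)=|\{x\in J:|f(x)-f(J)|>t\}|$ is the distribution function of $f-f(J)$ on $J$. *)

theory Defs
  imports "HOL-Analysis.Analysis"
begin

section \<open>Cubes\<close>

text \<open>Cubes are closed and nondegenerate; \<open>a\<close> is the corner with the smallest coordinates.\<close>

definition cube :: "real ^ 'n \<Rightarrow> real \<Rightarrow> (real ^ 'n) set" where
  "cube a l = cbox a (a + (\<chi> i. l))"

definition cubes :: "(real ^ 'n) set set" where
  "cubes = {cube a l | a l. l > 0}"

definition edge_length :: "(real ^ 'n) set \<Rightarrow> real" where
  "edge_length I = (THE l. l > 0 \<and> (\<exists>a. I = cube a l))"

lemma cube_eq_iff:
  fixes a b :: "real ^ 'n"
  assumes "l > 0" "r > 0"
  shows "cube a l = cube b r \<longleftrightarrow> a = b \<and> l = r"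
proof
  assume eq: "cube a l = cube b r"
  have "a \<in> cube a l" "a + (\<chi> i. l) \<in> cube a l" "b \<in> cube b r" "b + (\<chi> i. r) \<in> cube b r"
    using assms by (auto simp: cube_def mem_box_cart)
  then have "a \<in> cube b r" "a + (\<chi> i. l) \<in> cube b r" "b \<in> cube a l" "b + (\<chi> i. r) \<in> cube a l"
    using eq by auto
  then have *: "b $ i \<le> a $ i" "a $ i + l \<le> b $ i + r" "a $ i \<le> b $ i" "b $ i + r \<le> a $ i + l" for i
    by (auto simp: cube_def mem_box_cart)
  then have ab: "a $ i = b $ i" for i
    by (simp add: antisym)
  moreover have "l = r"
    using *(2,4)[of undefined] ab[of undefined] by simp
  ultimately show "a = b \<and> l = r"
    by (simp add: vec_eq_iff)
qed simp

lemma edge_length_cube: "l > 0 \<Longrightarrow> edge_length (cube a l) = l"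
  unfolding edge_length_def by (rule the_equality) (auto simp: cube_eq_iff)

text \<open>The \<open>2\<^sup>n\<close> cubes arising from one bipartition of every edge.\<close>

definition bisect :: "(real ^ 'n) set \<Rightarrow> (real ^ 'n) set set" where
  "bisect I = {cube (a + (l / 2) *\<^sub>R e) (l / 2) | a l e.
     l > 0 \<and> I = cube a l \<and> (\<forall>i. e $ i \<in> {0, 1})}"

primrec dyadic :: "nat \<Rightarrow> (real ^ 'n) set \<Rightarrow> (real ^ 'n) set set" where
  "dyadic 0 I = {I}"
| "dyadic (Suc k) I = (\<Union>J\<in>dyadic k I. bisect J)"

text \<open>
  Explicit description and cardinality of the dyadic subcubes. In particular the families are
  finite, so that sums over them do not degenerate to zero.
\<close>

lemma bisect_cube:
  "l > 0 \<Longrightarrow> bisect (cube a l) = {cube (a + (l / 2) *\<^sub>R e) (l / 2) | e. \<forall>i. e $ i \<in> {0, 1}}"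
  unfolding bisect_def by (auto simp: cube_eq_iff)

definition lattice_points :: "nat \<Rightarrow> (real ^ 'n) set" where
  "lattice_points N = {m. \<forall>i. m $ i \<in> real ` {..<N}}"

lemma lattice_points_double:
  "lattice_points (2 * N) = {2 *\<^sub>R m + e | m e :: real ^ 'n. m \<in> lattice_points N \<and> (\<forall>i. e $ i \<in> {0, 1})}"
proof (intro equalityI subsetI)
  fix v :: "real ^ 'n" assume "v \<in> lattice_points (2 * N)"
  then have "\<forall>i. \<exists>j. j < 2 * N \<and> v $ i = real j"
    by (auto simp: lattice_points_def)
  then obtain j where j: "\<And>i. j i < 2 * N" "\<And>i. v $ i = real (j i)"
    by metis
  define m :: "real ^ 'n" where "m = (\<chi> i. real (j i div 2))"
  define e :: "real ^ 'n" where "e = (\<chi> i. real (j i mod 2))"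
  have "v = 2 *\<^sub>R m + e"
    unfolding vec_eq_iff
  proof
    fix i
    have "real (j i) = real (2 * (j i div 2) + j i mod 2)"
      by simp
    then show "v $ i = (2 *\<^sub>R m + e) $ i"
      by (simp only: of_nat_add of_nat_mult) (simp add: m_def e_def j)
  qed
  moreover have "m \<in> lattice_points N"
    using j(1) by (auto simp: lattice_points_def m_def intro!: imageI less_mult_imp_div_less simp: mult.commute)
  moreover have "\<forall>i. e $ i \<in> {0, 1}"
    by (auto simp: e_def)
  ultimately show "v \<in> {2 *\<^sub>R m + e | m e. m \<in> lattice_points N \<and> (\<forall>i. e $ i \<in> {0, 1})}"
    by blast
next
  fix v :: "real ^ 'n"
  assume "v \<in> {2 *\<^sub>R m + e | m e. m \<in> lattice_points N \<and> (\<forall>i. e $ i \<in> {0, 1})}"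
  then obtain m e where v: "v = 2 *\<^sub>R m + e"
    and m: "m \<in> lattice_points N" and e: "\<forall>i. e $ i \<in> {0, 1}"
    by blast
  show "v \<in> lattice_points (2 * N)"
    unfolding lattice_points_def
  proof safe
    fix i
    obtain j where j: "j < N" "m $ i = real j"
      using m by (auto simp: lattice_points_def)
    show "v $ i \<in> real ` {..<2 * N}"
    proof (cases "e $ i = 0")
      case True
      then show ?thesis
        using j by (intro image_eqI[of _ _ "2 * j"]) (auto simp: v)
    next
      case False
      then have "e $ i = 1" using e by auto
      then show ?thesis
        using j by (intro image_eqI[of _ _ "2 * j + 1"]) (auto simp: v)
    qed
  qed
qed

lemma dyadic_cube:
  fixes a :: "real ^ 'n"
  assumes "l > 0"
  shows "dyadic k (cube a l) = (\<lambda>m. cube (a + (l / 2 ^ k) *\<^sub>R m) (l / 2 ^ k)) ` lattice_points (2 ^ k)"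
proof (induction k)
  case 0
  have "lattice_points (Suc 0) = {0 :: real ^ 'n}"
    by (auto simp: lattice_points_def vec_eq_iff lessThan_Suc)
  then show ?case by simp
next
  case (Suc k)
  let ?r = "l / 2 ^ Suc k"
  have "dyadic (Suc k) (cube a l) =
      (\<Union>m\<in>lattice_points (2 ^ k). bisect (cube (a + (l / 2 ^ k) *\<^sub>R m) (l / 2 ^ k)))"
    by (simp add: Suc)
  also have "\<dots> = (\<Union>m\<in>lattice_points (2 ^ k).
      {cube (a + (l / 2 ^ k) *\<^sub>R m + ?r *\<^sub>R e) ?r | e. \<forall>i. e $ i \<in> {0, 1}})"
    using assms by (simp add: bisect_cube mult.commute)
  also have "\<dots> = (\<Union>m\<in>lattice_points (2 ^ k).
      {cube (a + ?r *\<^sub>R (2 *\<^sub>R m + e)) ?r | e. \<forall>i. e $ i \<in> {0, 1}})"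
    by (simp add: scaleR_add_right add.assoc)
  also have "\<dots> = (\<lambda>m. cube (a + ?r *\<^sub>R m) ?r) `
      {2 *\<^sub>R m + e | m e. m \<in> lattice_points (2 ^ k) \<and> (\<forall>i. e $ i \<in> {0, 1})}"
    by blast
  finally show ?case
    by (simp only: lattice_points_double[symmetric] power_Suc)
qed

lemma card_lattice_points: "card (lattice_points N :: (real ^ 'n) set) = N ^ CARD('n)"
proof -
  have "bij_betw (\<lambda>x. \<chi> i. x i) (PiE UNIV (\<lambda>_ :: 'n. real ` {..<N})) (lattice_points N)"
    by (rule bij_betw_byWitness[where f' = "\<lambda>v i. v $ i"])
      (auto simp: lattice_points_def PiE_def Pi_def extensional_def)
  then have "card (lattice_points N :: (real ^ 'n) set)
      = card (PiE UNIV (\<lambda>_ :: 'n. real ` {..<N}))"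
    by (simp add: bij_betw_same_card)
  also have "\<dots> = N ^ CARD('n)"
    by (simp add: card_PiE card_image)
  finally show ?thesis .
qed

lemma card_dyadic:
  fixes I :: "(real ^ 'n) set"
  assumes "I \<in> cubes"
  shows "card (dyadic k I) = 2 ^ (k * CARD('n))"
proof -
  obtain a l where I: "l > 0" "I = cube a l"
    using assms by (auto simp: cubes_def)
  have "inj_on (\<lambda>m. cube (a + (l / 2 ^ k) *\<^sub>R m) (l / 2 ^ k)) (lattice_points (2 ^ k))"
    using I by (auto simp: inj_on_def cube_eq_iff)
  then show ?thesis
    using I by (simp add: dyadic_cube card_image card_lattice_points power_mult)
qed

lemma finite_dyadic: "I \<in> cubes \<Longrightarrow> finite (dyadic k I)"
  using card_dyadic[of I k] by (metis card.infinite power_not_zero zero_neq_numeral)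


section \<open>Locally integrable functions, mean values and distribution functions\<close>

definition locally_integrable :: "(real ^ 'n \<Rightarrow> complex) \<Rightarrow> bool" where
  "locally_integrable f \<longleftrightarrow> (\<forall>K. compact K \<longrightarrow> f absolutely_integrable_on K)"

definition mean :: "(real ^ 'n \<Rightarrow> complex) \<Rightarrow> (real ^ 'n) set \<Rightarrow> complex" where
  "mean f J = (LINT x:J|lebesgue. f x) /\<^sub>R measure lebesgue J"

definition distr_fun :: "(real ^ 'n \<Rightarrow> complex) \<Rightarrow> (real ^ 'n) set \<Rightarrow> real \<Rightarrow> ennreal" where
  "distr_fun f J t = emeasure lebesgue {x \<in> J. norm (f x - mean f J) > t}"


section \<open>The spaces \<open>Q\<^sub>\<alpha>\<^sup>\<beta>\<close>\<close>

definition sqrt_ennreal :: "ennreal \<Rightarrow> ennreal" where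
  "sqrt_ennreal x = (if x = \<infinity> then \<infinity> else ennreal (sqrt (enn2real x)))"

text \<open>
  The integrand is \<open>0\<close> on the diagonal \<open>x = y\<close> because of \<open>0 powr s = 0\<close> and \<open>z / 0 = 0\<close>;
  the diagonal is a null set.
\<close>

definition Q_norm :: "real \<Rightarrow> real \<Rightarrow> (real ^ 'n \<Rightarrow> complex) \<Rightarrow> ennreal" where
  "Q_norm \<alpha> \<beta> f = (SUP I\<in>cubes. sqrt_ennreal (
     ennreal (edge_length I powr (2 * (\<alpha> + \<beta> - 1) - real CARD('n))) *
     (\<integral>\<^sup>+ y\<in>I. (\<integral>\<^sup>+ x\<in>I. ennreal ((norm (f x - f y))\<^sup>2 /
        norm (x - y) powr (real CARD('n) + 2 * (\<alpha> - \<beta> + 1))) \<partial>lebesgue) \<partial>lebesgue)))"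

definition Q_space :: "real \<Rightarrow> real \<Rightarrow> (real ^ 'n \<Rightarrow> complex) set" where
  "Q_space \<alpha> \<beta> = {f. f \<in> borel_measurable lebesgue \<and> Q_norm \<alpha> \<beta> f < \<infinity>}"

end

theory Submission
  imports Defs
begin

text \<open>
  Integrating the hypothesis against \<open>2t dt\<close> over \<open>t > 0\<close> turns it into a bound for the weighted
  dyadic sum of the mean square oscillations of \<open>f\<close>; the right-hand side is integrable at \<open>0\<close>
  because \<open>p < 2\<close>. Conversely, by the one-third trick, any two distinct points of a cube \<open>I\<close> of edge
  length \<open>l\<close> lie in a common dyadic subcube, of size comparable to their distance, of one of
  \<open>2\<^sup>n\<close> shifted cubes of edge length \<open>2l\<close>. Hence the kernel defining the norm is dominated
  pointwise by a sum over these subcubes, and termwise integration bounds it by the dyadic sums of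
  the shifted cubes.
\<close>

section \<open>Layer-cake formula\<close>

text \<open>A countable cover by Borel sets of finite \<open>lborel\<close> measure also serves for
  the completion, which agrees with \<open>lborel\<close> on Borel sets.\<close>

lemma sigma_finite_lebesgue: "sigma_finite_measure (lebesgue :: 'a::euclidean_space measure)"
proof -
  obtain A :: "'a set set" where A: "countable A" "A \<subseteq> sets lborel" "\<Union>A = space lborel"
    "\<forall>a\<in>A. emeasure lborel a \<noteq> \<infinity>"
    using lborel.sigma_finite_countable by blast
  show ?thesis
    by standard (use A in \<open>intro exI[of _ A]; auto\<close>)
qed

text \<open>Setting for Tonelli with mixed factors: the point \<open>x\<close> carries the completed
  measure because \<open>f\<close> is only Lebesgue measurable, the level \<open>t\<close> the Borel
  one.\<close>

lemma pair_sigma_finite_lebesgue_lborel: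
  "pair_sigma_finite (lebesgue :: 'a::euclidean_space measure) (lborel :: real measure)"
  by (intro pair_sigma_finite.intro sigma_finite_lebesgue lborel.sigma_finite_measure_axioms)

text \<open>The value at \<open>t\<close> is an integral over \<open>x\<close> of a function jointly
  measurable in level and point, so it depends measurably on \<open>t\<close>.\<close>

lemma borel_measurable_distr_fun:
  fixes f :: "real ^ 'n \<Rightarrow> complex"
  assumes [measurable]: "f \<in> borel_measurable lebesgue" "J \<in> sets lebesgue"
  shows "distr_fun f J \<in> borel_measurable borel"
proof -
  interpret sigma_finite_measure "lebesgue :: (real ^ 'n) measure"
    by (rule sigma_finite_lebesgue)
  let ?A = "\<lambda>t. {x \<in> J. norm (f x - mean f J) > t}"
  have "distr_fun f J t = (\<integral>\<^sup>+ x. indicator J x * indicator {t<..} (norm (f x - mean f J)) \<partial>lebesgue)"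
    for t
  proof -
    have "?A t \<in> sets lebesgue"
      by measurable
    then have "distr_fun f J t = (\<integral>\<^sup>+ x. indicator (?A t) x \<partial>lebesgue)"
      by (simp add: distr_fun_def)
    also have "\<dots> = (\<integral>\<^sup>+ x. indicator J x * indicator {t<..} (norm (f x - mean f J)) \<partial>lebesgue)"
      by (intro nn_integral_cong) (auto split: split_indicator)
    finally show ?thesis .
  qed
  moreover have "(\<lambda>t. \<integral>\<^sup>+ x. indicator J x * indicator {t<..} (norm (f x - mean f J)) \<partial>lebesgue)
      \<in> borel_measurable (borel :: real measure)"
    unfolding indicator_def greaterThan_iff by measurable
  ultimately show ?thesis
    by (simp cong: measurable_cong)
qed

text \<open>Each square is the integral of \<open>2 * t\<close> over \<open>0 < t < h x\<close>;
  Tonelli then exchanges \<open>x\<close> and \<open>t\<close>.\<close>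

lemma nn_integral_square_layer_cake:
  fixes f :: "real ^ 'n \<Rightarrow> complex"
  assumes [measurable]: "f \<in> borel_measurable lebesgue" "J \<in> sets lebesgue"
  shows "(\<integral>\<^sup>+ x\<in>J. ennreal ((norm (f x - mean f J))\<^sup>2) \<partial>lebesgue)
    = (\<integral>\<^sup>+ t\<in>{0<..}. ennreal (2 * t) * distr_fun f J t \<partial>lborel)"
proof -
  interpret pair_sigma_finite "lebesgue :: (real ^ 'n) measure" "lborel :: real measure"
    by (rule pair_sigma_finite_lebesgue_lborel)
  define h where "h x = norm (f x - mean f J)" for x
  have [measurable]: "h \<in> borel_measurable lebesgue"
    unfolding h_def by measurable
  \<comment> \<open>The open interval matches the strict inequality in \<open>distr_fun\<close>; its
    endpoints form a null set, so it may be closed for the fundamental theorem of calculus.\<close>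
  have sq: "ennreal ((h x)\<^sup>2) = (\<integral>\<^sup>+ t. ennreal (2 * t) * indicator {0<..<h x} t \<partial>lborel)" for x
  proof -
    have "(\<integral>\<^sup>+ t. ennreal (2 * t) * indicator {0<..<h x} t \<partial>lborel)
        = (\<integral>\<^sup>+ t. ennreal (2 * t) * indicator {0..h x} t \<partial>lborel)"
      using AE_lborel_singleton[of "0::real"] AE_lborel_singleton[of "h x"]
      by (intro nn_integral_cong_AE) (auto elim!: eventually_elim2 split: split_indicator)
    also have "\<dots> = ennreal ((h x)\<^sup>2 - 0\<^sup>2)"
      by (rule nn_integral_FTC_Icc) (auto simp: h_def intro!: derivative_eq_intros)
    finally show ?thesis by simp
  qed
  have "(\<integral>\<^sup>+ x\<in>J. ennreal ((h x)\<^sup>2) \<partial>lebesgue)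
      = (\<integral>\<^sup>+ x. (\<integral>\<^sup>+ t. ennreal (2 * t) * indicator {0<..<h x} t * indicator J x \<partial>lborel) \<partial>lebesgue)"
    by (simp add: sq nn_integral_multc)
  also have "\<dots> = (\<integral>\<^sup>+ t. (\<integral>\<^sup>+ x. ennreal (2 * t) * indicator {0<..<h x} t * indicator J x \<partial>lebesgue) \<partial>lborel)"
    by (rule Fubini'[symmetric]) (unfold indicator_def greaterThanLessThan_iff, measurable)
  also have "\<dots> = (\<integral>\<^sup>+ t\<in>{0<..}. ennreal (2 * t) * distr_fun f J t \<partial>lborel)"
  proof (intro nn_integral_cong)
    fix t :: real
    have [measurable]: "{x \<in> J. h x > t} \<in> sets lebesgue"
      by measurable
    have "(\<integral>\<^sup>+ x. ennreal (2 * t) * indicator {0<..<h x} t * indicator J x \<partial>lebesgue)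
        = (\<integral>\<^sup>+ x. (ennreal (2 * t) * indicator {0<..} t) * indicator {x \<in> J. h x > t} x \<partial>lebesgue)"
      by (intro nn_integral_cong) (auto split: split_indicator)
    also have "\<dots> = ennreal (2 * t) * distr_fun f J t * indicator {0<..} t"
      by (simp add: nn_integral_cmult distr_fun_def h_def mult_ac)
    finally show "(\<integral>\<^sup>+ x. ennreal (2 * t) * indicator {0<..<h x} t * indicator J x \<partial>lebesgue)
        = ennreal (2 * t) * distr_fun f J t * indicator {0<..} t" .
  qed
  finally show ?thesis by (simp add: h_def)
qed

section \<open>Mean square oscillation over dyadic cubes\<close>

lemma dyadic_subset_cubes: "I \<in> cubes \<Longrightarrow> dyadic k I \<subseteq> cubes"
  by (auto simp: cubes_def dyadic_cube) (metis divide_pos_pos zero_less_numeral zero_less_power)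

lemma cube_in_cubes: "l > 0 \<Longrightarrow> cube a l \<in> cubes"
  unfolding cubes_def by blast

lemma sets_cubes: "J \<in> cubes \<Longrightarrow> J \<in> sets lebesgue"
  by (auto simp: cubes_def cube_def)

lemma emeasure_cube:
  fixes a :: "real ^ 'n"
  assumes "l > 0"
  shows "emeasure lebesgue (cube a l) = ennreal (l ^ CARD('n))"
proof -
  have "emeasure lebesgue (cube a l) = ennreal (measure lborel (cube a l))"
    using emeasure_lborel_cbox_finite[of a "a + (\<chi> i. l)"]
    by (simp add: cube_def emeasure_eq_ennreal_measure less_top[symmetric])
  also have "measure lborel (cube a l) = l ^ CARD('n)"
    using assms unfolding cube_def by (subst content_cbox_cart) (auto simp: interval_eq_empty_cart not_less)
  finally show ?thesis .
qed

text \<open>The variance of \<open>f\<close> over \<open>J\<close>, valued in \<open>ennreal\<close>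
  because local integrability alone leaves open whether the square integral is finite.\<close>

definition mean_square_osc :: "(real ^ 'n \<Rightarrow> complex) \<Rightarrow> (real ^ 'n) set \<Rightarrow> ennreal" where
  "mean_square_osc f J =
     (\<integral>\<^sup>+ x\<in>J. ennreal ((norm (f x - mean f J))\<^sup>2) \<partial>lebesgue) / emeasure lebesgue J"

text \<open>Integrate the bound against \<open>2 * t\<close>: by the layer-cake formula each
  distribution function becomes a square integral, and Tonelli passes the integral through the
  nonnegative sums.\<close>

lemma dyadic_osc_sum_le:
  fixes f :: "real ^ 'n \<Rightarrow> complex" and w :: "nat \<Rightarrow> ennreal"
  assumes [measurable]: "f \<in> borel_measurable lebesgue" and I: "I \<in> cubes"
    and le: "\<And>t. t > 0 \<Longrightarrow>
      A * (\<Sum>k. w k * (\<Sum>J\<in>dyadic k I. distr_fun f J t / emeasure lebesgue J)) \<le> ennreal (\<Phi> t)"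
  shows "A * (\<Sum>k. w k * (\<Sum>J\<in>dyadic k I. mean_square_osc f J))
    \<le> (\<integral>\<^sup>+ t\<in>{0<..}. ennreal (2 * t * \<Phi> t) \<partial>lborel)"
proof -
  define D where "D J t = distr_fun f J t / emeasure lebesgue J" for J t
  have D [measurable]: "D J \<in> borel_measurable borel" if "J \<in> dyadic k I" for J k
  proof -
    have [measurable]: "distr_fun f J \<in> borel_measurable borel"
      using that I dyadic_subset_cubes[of I k] by (intro borel_measurable_distr_fun) (auto simp: sets_cubes)
    show ?thesis
      unfolding D_def by measurable
  qed
  let ?u = "\<lambda>t::real. ennreal (2 * t) * indicator {0<..} t"
  have osc: "mean_square_osc f J = (\<integral>\<^sup>+ t. ?u t * D J t \<partial>lborel)" if J: "J \<in> dyadic k I" for J k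
  proof -
    have [measurable]: "J \<in> sets lebesgue"
      using J I dyadic_subset_cubes[of I k] by (auto simp: sets_cubes)
    then have [measurable]: "distr_fun f J \<in> borel_measurable borel"
      by (intro borel_measurable_distr_fun) auto
    have "mean_square_osc f J
        = (\<integral>\<^sup>+ t. ennreal (2 * t) * distr_fun f J t * indicator {0<..} t / emeasure lebesgue J \<partial>lborel)"
      unfolding mean_square_osc_def
      by (subst nn_integral_square_layer_cake) (auto simp: nn_integral_divide)
    then show ?thesis
      by (simp add: D_def divide_ennreal_def mult_ac)
  qed
  have "A * (\<Sum>k. w k * (\<Sum>J\<in>dyadic k I. mean_square_osc f J))
      = A * (\<Sum>k. w k * (\<Sum>J\<in>dyadic k I. \<integral>\<^sup>+ t. ?u t * D J t \<partial>lborel))"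
    by (simp add: osc cong: sum.cong)
  also have "\<dots> = A * (\<Sum>k. w k * (\<integral>\<^sup>+ t. (\<Sum>J\<in>dyadic k I. ?u t * D J t) \<partial>lborel))"
    by (subst nn_integral_sum) auto
  also have "\<dots> = A * (\<Sum>k. \<integral>\<^sup>+ t. w k * (\<Sum>J\<in>dyadic k I. ?u t * D J t) \<partial>lborel)"
    by (subst nn_integral_cmult) auto
  also have "\<dots> = A * (\<integral>\<^sup>+ t. (\<Sum>k. w k * (\<Sum>J\<in>dyadic k I. ?u t * D J t)) \<partial>lborel)"
    by (subst nn_integral_suminf) auto
  also have "\<dots> = (\<integral>\<^sup>+ t. A * (\<Sum>k. w k * (\<Sum>J\<in>dyadic k I. ?u t * D J t)) \<partial>lborel)"
    by (subst nn_integral_cmult) auto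
  \<comment> \<open>The level weight \<open>?u\<close> comes out of both sums, so that the bound
    \<open>le\<close> applies pointwise in \<open>t\<close>.\<close>
  also have "\<dots> = (\<integral>\<^sup>+ t. ?u t * (A * (\<Sum>k. w k * (\<Sum>J\<in>dyadic k I. D J t))) \<partial>lborel)"
    by (simp add: sum_distrib_left[symmetric] mult.left_commute[of "w _"] ennreal_suminf_cmult)
       (simp add: mult_ac)
  also have "\<dots> \<le> (\<integral>\<^sup>+ t\<in>{0<..}. ennreal (2 * t * \<Phi> t) \<partial>lborel)"
  proof (intro nn_integral_mono)
    fix t :: real
    show "?u t * (A * (\<Sum>k. w k * (\<Sum>J\<in>dyadic k I. D J t))) \<le> ennreal (2 * t * \<Phi> t) * indicator {0<..} t"
    proof (cases "t > 0")
      case True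
      then have "?u t * (A * (\<Sum>k. w k * (\<Sum>J\<in>dyadic k I. D J t))) \<le> ennreal (2 * t) * ennreal (\<Phi> t)"
        using le[of t] by (auto simp: D_def intro!: mult_left_mono)
      then show ?thesis
        using True by (simp add: ennreal_mult')
    qed simp
  qed
  finally show ?thesis .
qed

section \<open>Integrability of the decay bound\<close>

lemma set_integrable_powr_exp:
  assumes "q > 0" "c > 0"
  shows "set_integrable lebesgue {0<..} (\<lambda>t::real. t powr (q - 1) * exp (- c * t))"
proof -
  \<comment> \<open>The complex Gamma integrand at the real exponent \<open>q\<close>, scaled by
    \<open>c\<close>; its norm is the real integrand sought.\<close>
  have "(\<lambda>t. norm (complex_of_real t powr (complex_of_real q - 1) / of_real (exp (c * t))))
      absolutely_integrable_on {0<..}"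
    using absolutely_integrable_Gamma_integral[of "of_real q" c] assms
    by (intro set_integrable_norm) auto
  then show ?thesis
    by (rule set_integrable_cong[THEN iffD1, rotated -1])
       (auto simp: norm_divide norm_powr_real_powr exp_minus field_simps)
qed

text \<open>Bounding the maximum by the sum leaves Gamma integrands with parameters \<open>2\<close>
  and \<open>2 - p\<close>; the second is positive because \<open>p < 2\<close>.\<close>

lemma nn_integral_weak_tail_finite:
  fixes B C c p :: real
  assumes "B > 0" "C > 0" "c > 0" "0 \<le> p" "p < 2"
  shows "(\<integral>\<^sup>+ t\<in>{0<..}. ennreal (2 * t * (B * max 1 ((C / t) powr p) * exp (- c * t))) \<partial>lborel) < \<infinity>"
proof -
  let ?g = "\<lambda>t. 2 * B * (t powr (2 - 1) * exp (- c * t)) + 2 * B * C powr p * (t powr (2 - p - 1) * exp (- c * t))"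
  have g: "set_integrable lebesgue {0<..} ?g"
    using assms by (intro set_integral_add set_integrable_mult_right set_integrable_powr_exp) auto
  have "2 * t * (B * max 1 ((C / t) powr p) * exp (- c * t)) \<le> ?g t" if t: "t > 0" for t
  proof -
    have "t * max 1 ((C / t) powr p) \<le> t * (1 + (C / t) powr p)"
      using t by (intro mult_left_mono) auto
    also have "\<dots> = t powr (2 - 1) + C powr p * t powr (2 - p - 1)"
      using t assms by (simp add: powr_divide powr_diff distrib_left field_simps)
    finally have "2 * B * exp (- c * t) * (t * max 1 ((C / t) powr p))
        \<le> 2 * B * exp (- c * t) * (t powr (2 - 1) + C powr p * t powr (2 - p - 1))"
      using assms by (intro mult_left_mono) auto
    then show ?thesis
      by (simp add: algebra_simps)
  qed
  then have "(\<integral>\<^sup>+ t\<in>{0<..}. ennreal (2 * t * (B * max 1 ((C / t) powr p) * exp (- c * t))) \<partial>lborel)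
      \<le> (\<integral>\<^sup>+ t. ennreal (norm (indicator {0<..} t *\<^sub>R ?g t)) \<partial>lborel)"
    by (intro nn_integral_mono) (auto split: split_indicator intro!: ennreal_leI order_trans[OF _ abs_ge_self])
  also have "\<dots> = (\<integral>\<^sup>+ t. ennreal (norm (indicator {0<..} t *\<^sub>R ?g t)) \<partial>lebesgue)"
    by (rule nn_integral_completion[symmetric])
  also have "\<dots> < \<infinity>"
    using g unfolding set_integrable_def integrable_iff_bounded by simp
  finally show ?thesis .
qed


section \<open>The one-third trick\<close>

text \<open>On the grid of mesh \<open>1 / 2 ^ k\<close> in the unit interval, \<open>j\<close>
  numbers a closed cell and \<open>s\<close> selects no shift or a shift by \<open>1 / 3\<close>.
  Placing both points in the left half leaves room for the shift. For \<open>k = 0\<close> the only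
  cell is the whole interval, so any two points share it.\<close>

lemma third_shift_1d:
  fixes u w :: real
  assumes "0 \<le> u" "u \<le> w" "w \<le> 1 / 2" and near: "3 * 2 ^ k * (w - u) < 1 \<or> k = 0"
  obtains s j :: nat where "s < 2" "j < 2 ^ k"
    "j \<le> 2 ^ k * (u + s / 3)" "2 ^ k * (w + s / 3) \<le> j + 1"
proof -
  define N :: nat where "N = 2 ^ k"
  define j where "j = nat \<lfloor>N * w\<rfloor>"
  have N: "N \<ge> 1"
    by (simp add: N_def)
  have j: "real j \<le> N * w" "N * w < real j + 1"
    using assms by (auto simp: j_def)
  have "N * w \<le> N * (1 / 2)"
    using assms by (intro mult_left_mono) auto
  then have jN: "2 * real j \<le> N"
    using j by linarith
  then have "j < N"
    using N by linarith
  show thesis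
  proof (cases "real j \<le> N * u")
    case True
    then show ?thesis
      using j \<open>j < N\<close> by (intro that[of 0 j]) (auto simp: N_def)
  next
    case False
    have "k \<noteq> 0"
    proof
      assume "k = 0"
      then have "j = 0"
        using jN by (simp add: N_def)
      then show False
        using False assms by simp
    qed
    then have near: "3 * (N * w) - 3 * (N * u) < 1"
      using near by (simp add: N_def algebra_simps)
    define q where "q = N div 3"
    \<comment> \<open>As \<open>N\<close> is not divisible by \<open>3\<close>, shifting by \<open>N / 3\<close> moves the grid point separating
      \<open>N * u\<close> and \<open>N * w\<close> at least \<open>1 / 3\<close> away from the nearest grid point.\<close>
    have "N mod 3 \<noteq> 0"
    proof
      assume "N mod 3 = 0"
      then have "(3::nat) dvd 2 ^ k"
        by (simp add: N_def mod_eq_0_iff_dvd)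
      then have "(3::nat) dvd 2"
        by (rule prime_dvd_power_nat[rotated]) simp
      then show False by simp
    qed
    then have "N = 3 * q + 1 \<or> N = 3 * q + 2"
      unfolding q_def by presburger
    then have q: "real N = 3 * q + 1 \<or> real N = 3 * q + 2"
      by auto
    \<comment> \<open>Here \<open>j \<le> N / 2\<close> and \<open>q < N / 3\<close>, so the index
      stays below \<open>5 * N / 6\<close>.\<close>
    have "real (j + q) < real N"
      using q jN by auto
    then have "j + q < N"
      by (simp only: of_nat_less_iff)
    \<comment> \<open>Now \<open>N * u < j \<le> N * w\<close>, both within \<open>1 / 3\<close> of
      \<open>j\<close>, while \<open>N / 3\<close> is \<open>q + 1 / 3\<close> or
      \<open>q + 2 / 3\<close>; hence both shifted points fall into cell
      \<open>j + q\<close>.\<close>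
    moreover have "real (j + q) \<le> N * (u + 1 / 3)"
      using q near j False unfolding distrib_left by linarith
    moreover have "N * (w + 1 / 3) \<le> real (j + q) + 1"
      using q near j False unfolding distrib_left by linarith
    ultimately show ?thesis
      by (intro that[of 1 "j + q"]) (auto simp: N_def)
  qed
qed

lemma mem_cube: "x \<in> cube a l \<longleftrightarrow> (\<forall>i. a $ i \<le> x $ i \<and> x $ i \<le> a $ i + l)"
  by (simp add: cube_def mem_box_cart)

text \<open>The shift is a third of the doubled edge, in the coordinates selected by
  \<open>v\<close>. For \<open>v\<close> in \<open>lattice_points 2\<close>, the vectors with
  entries 0 and 1, the result still contains \<open>cube a l\<close>, since
  \<open>2 * l - 2 * l / 3 \<ge> l\<close>.\<close>

definition shifted_double :: "real ^ 'n \<Rightarrow> real \<Rightarrow> real ^ 'n \<Rightarrow> (real ^ 'n) set" where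
  "shifted_double a l v = cube (a - (2 * l / 3) *\<^sub>R v) (2 * l)"

lemma shifted_double_in_cubes: "l > 0 \<Longrightarrow> shifted_double a l v \<in> cubes"
  by (simp add: shifted_double_def cube_in_cubes)

text \<open>The one-dimensional shift is chosen independently in every coordinate, which is why
  \<open>v\<close> ranges over all vectors with entries 0 and 1.\<close>

lemma third_shift_cube:
  fixes x y a :: "real ^ 'n"
  assumes l: "l > 0" and x: "x \<in> cube a l" and y: "y \<in> cube a l"
    and near: "(\<forall>i. \<bar>x $ i - y $ i\<bar> < 2 * l / (3 * 2 ^ k)) \<or> k = 0"
  obtains v J where "v \<in> lattice_points 2" "J \<in> dyadic k (shifted_double a l v)" "x \<in> J" "y \<in> J"
proof -
  let ?r = "2 * l / 2 ^ k"
  have "\<exists>s j. s < 2 \<and> j < 2 ^ k \<and>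
      (\<forall>z\<in>{x $ i, y $ i}. a $ i - 2 * l / 3 * real s + ?r * real j \<le> z \<and>
         z \<le> a $ i - 2 * l / 3 * real s + ?r * real j + ?r)" for i
  proof -
    \<comment> \<open>Coordinates are rescaled so that the doubled edge has length 1; membership in
      \<open>cube a l\<close> puts both points in the left half.\<close>
    define u where "u = (min (x $ i) (y $ i) - a $ i) / (2 * l)"
    define w where "w = (max (x $ i) (y $ i) - a $ i) / (2 * l)"
    have bounds: "a $ i \<le> min (x $ i) (y $ i)" "max (x $ i) (y $ i) \<le> a $ i + l"
      using x y by (auto simp: mem_cube)
    have near': "3 * 2 ^ k * (w - u) < 1 \<or> k = 0"
    proof (cases "k = 0")
      case False
      have "w - u = \<bar>x $ i - y $ i\<bar> / (2 * l)"
        unfolding u_def w_def diff_divide_distrib[symmetric] by (auto simp: max_def min_def)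
      then have "3 * 2 ^ k * (w - u) = \<bar>x $ i - y $ i\<bar> / (2 * l / (3 * 2 ^ k))"
        by simp
      also have "\<dots> < 1"
        using near l False by (subst divide_less_eq_1_pos) auto
      finally show ?thesis by simp
    qed auto
    obtain s j :: nat where sj: "s < 2" "j < 2 ^ k"
      "j \<le> 2 ^ k * (u + s / 3)" "2 ^ k * (w + s / 3) \<le> j + 1"
    proof (rule third_shift_1d[of u w k])
      show "0 \<le> u" "u \<le> w" "w \<le> 1 / 2"
        using bounds l by (auto simp: u_def w_def divide_simps)
    qed (use near' in auto)
    have "?r * j \<le> ?r * (2 ^ k * (u + s / 3))"
      using sj l by (intro mult_left_mono) auto
    also have "\<dots> = min (x $ i) (y $ i) - a $ i + 2 * l / 3 * s"
      using l by (simp add: u_def field_simps)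
    finally have lo: "a $ i - 2 * l / 3 * real s + ?r * real j \<le> min (x $ i) (y $ i)"
      by linarith
    have "max (x $ i) (y $ i) - a $ i + 2 * l / 3 * s = ?r * (2 ^ k * (w + s / 3))"
      using l by (simp add: w_def field_simps)
    also have "\<dots> \<le> ?r * (j + 1)"
      using sj l by (intro mult_left_mono) auto
    also have "\<dots> = ?r * j + ?r"
      by (simp only: of_nat_add of_nat_1 distrib_left mult_1_right)
    finally have "max (x $ i) (y $ i) \<le> a $ i - 2 * l / 3 * real s + ?r * real j + ?r"
      by linarith
    with lo sj show ?thesis
      by (intro exI[of _ s] exI[of _ j]) auto
  qed
  then obtain s j where sj: "\<And>i. s i < 2" "\<And>i. j i < 2 ^ k"
    "\<And>i z. z \<in> {x $ i, y $ i} \<Longrightarrow> a $ i - 2 * l / 3 * real (s i) + ?r * real (j i) \<le> z \<and>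
         z \<le> a $ i - 2 * l / 3 * real (s i) + ?r * real (j i) + ?r"
    by metis
  define v :: "real ^ 'n" where "v = (\<chi> i. real (s i))"
  define m :: "real ^ 'n" where "m = (\<chi> i. real (j i))"
  define J where "J = cube (a - (2 * l / 3) *\<^sub>R v + ?r *\<^sub>R m) ?r"
  show thesis
  proof (rule that)
    show "v \<in> lattice_points 2"
      using sj(1) by (auto simp: lattice_points_def v_def)
    have "m \<in> lattice_points (2 ^ k)"
      using sj(2) by (auto simp: lattice_points_def m_def)
    then show "J \<in> dyadic k (shifted_double a l v)"
      unfolding J_def shifted_double_def using l by (auto simp: dyadic_cube intro!: image_eqI[of _ _ m])
    show "x \<in> J" "y \<in> J"
      using sj(3) by (auto simp: J_def mem_cube v_def m_def)
  qed
qed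

text \<open>The scale is the last one before a third of the cell edge drops to the maximum-norm
  distance or below. The \<open>6\<close> is this \<open>3\<close> times a factor 2 for stepping
  back one scale.\<close>

lemma exists_dyadic_scale:
  fixes x y :: "real ^ 'n"
  assumes l: "l > 0" and "x \<noteq> y" and x: "x \<in> cube a l" and y: "y \<in> cube a l"
  obtains k where "(\<forall>i. \<bar>x $ i - y $ i\<bar> < 2 * l / (3 * 2 ^ k)) \<or> k = 0"
    "(2 * l / 2 ^ k) / 6 \<le> norm (x - y)"
proof -
  define d where "d = infnorm (x - y)"
  have d: "d > 0" "d \<le> norm (x - y)" "\<And>i. \<bar>x $ i - y $ i\<bar> \<le> d"
    using \<open>x \<noteq> y\<close> component_le_infnorm_cart[of "x - y"]
    by (auto simp: d_def infnorm_pos_lt infnorm_le_norm)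
  define P where "P k \<longleftrightarrow> 2 * l / (3 * 2 ^ k) \<le> d" for k :: nat
  obtain m where "2 * l / (3 * d) < 2 ^ m"
    using real_arch_pow[of 2] by auto
  then have "P m"
    using d by (simp add: P_def field_simps)
  \<comment> \<open>This is the first scale that is too fine, so the witness is its predecessor, or
    \<open>0\<close> if even the coarsest scale is too fine.\<close>
  define k where "k = (LEAST k. P k)"
  have k: "P k"
    unfolding k_def by (rule LeastI) fact
  show thesis
  proof (cases k)
    case 0
    then show ?thesis
      using k d l by (intro that[of 0]) (auto simp: P_def)
  next
    case (Suc k')
    then have "\<not> P k'"
      unfolding k_def by (intro not_less_Least) simp
    then have "\<bar>x $ i - y $ i\<bar> < 2 * l / (3 * 2 ^ k')" for i
      using d(3)[of i] by (simp add: P_def)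
    moreover have "(2 * l / 2 ^ k') / 6 \<le> norm (x - y)"
      using k d Suc by (simp add: P_def)
    ultimately show ?thesis
      by (intro that[of k']) auto
  qed
qed

lemma norm_diff_le_of_mem_cube:
  fixes x y :: "real ^ 'n" and r :: real
  assumes "x \<in> cube b r" "y \<in> cube b r"
  shows "norm (x - y) \<le> CARD('n) * r"
proof -
  have "\<bar>(x - y) $ i\<bar> \<le> r" for i
    using assms[unfolded mem_cube, THEN spec[of _ i]] by auto
  then have "(\<Sum>i\<in>UNIV. \<bar>(x - y) $ i\<bar>) \<le> (\<Sum>i\<in>(UNIV::'n set). r)"
    by (intro sum_mono)
  then show ?thesis
    using norm_le_l1_cart[of "x - y"] by simp
qed

text \<open>The exponent \<open>s\<close> may have either sign, so \<open>d powr - s\<close> is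
  bounded by the sum of its values at both ends of the range of \<open>d\<close>.\<close>

lemma powr_le_of_comparable:
  fixes r d s :: real
  assumes "0 < r" "r / 6 \<le> d" "d \<le> N * r"
  shows "1 / d powr s \<le> ((1 / 6) powr - s + N powr - s) * r powr - s"
proof -
  have d: "d > 0"
    using assms by auto
  then have "N * r > 0"
    using assms by linarith
  then have N: "N > 0"
    using assms by (simp add: zero_less_mult_iff)
  have "1 / d powr s = d powr - s"
    by (simp add: powr_minus_divide)
  also have "\<dots> \<le> (r / 6) powr - s + (N * r) powr - s"
  proof (cases "s \<ge> 0")
    case True
    then have "d powr - s \<le> (r / 6) powr - s"
      using assms by (intro powr_mono2') auto
    then show ?thesis
      by (simp add: add_increasing2)
  next
    case False
    then have "d powr - s \<le> (N * r) powr - s"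
      using assms d by (intro powr_mono2) auto
    then show ?thesis
      by (simp add: add_increasing)
  qed
  also have "\<dots> = ((1 / 6) powr - s + N powr - s) * r powr - s"
    using assms N powr_mult[of "1/6" r "- s"] powr_mult[of N r "- s"] by (simp add: distrib_right)
  finally show ?thesis .
qed


section \<open>Dyadic sums control the double integral\<close>

text \<open>A single term suffices: take \<open>k\<close> comparable to the distance, then
  \<open>v\<close> and a cube \<open>J\<close> containing both points, and compare
  \<open>f x\<close> and \<open>f y\<close> through \<open>c J\<close>.\<close>

lemma kernel_le_dyadic_sum:
  fixes f :: "real ^ 'n \<Rightarrow> complex" and c :: "(real ^ 'n) set \<Rightarrow> complex"
  assumes l: "l > 0" and x: "x \<in> cube a l" and y: "y \<in> cube a l"
  shows "ennreal ((norm (f x - f y))\<^sup>2 / norm (x - y) powr s)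
    \<le> (\<Sum>v\<in>lattice_points 2. \<Sum>k. \<Sum>J\<in>dyadic k (shifted_double a l v).
         ennreal (((1 / 6) powr - s + CARD('n) powr - s) * (2 * l / 2 ^ k) powr - s) *
         (2 * (ennreal ((norm (f x - c J))\<^sup>2) + ennreal ((norm (f y - c J))\<^sup>2)) *
          indicator J x * indicator J y))"
    (is "_ \<le> (\<Sum>v\<in>_. \<Sum>k. \<Sum>J\<in>_. ?g k J)")
proof (cases "x = y")
  case False
  obtain k where near: "(\<forall>i. \<bar>x $ i - y $ i\<bar> < 2 * l / (3 * 2 ^ k)) \<or> k = 0"
    and lo: "(2 * l / 2 ^ k) / 6 \<le> norm (x - y)"
    using exists_dyadic_scale[OF l False x y] by blast
  obtain v J where v: "v \<in> lattice_points 2" and J: "J \<in> dyadic k (shifted_double a l v)"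
    and xJ: "x \<in> J" and yJ: "y \<in> J"
    using third_shift_cube[OF l x y near] by blast
  let ?r = "2 * l / 2 ^ k" and ?K = "(1 / 6) powr - s + CARD('n) powr - s"
  obtain b where "J = cube b ?r"
    using J l by (auto simp: shifted_double_def dyadic_cube)
  then have "norm (x - y) \<le> CARD('n) * ?r"
    using xJ yJ norm_diff_le_of_mem_cube by blast
  then have ker: "1 / norm (x - y) powr s \<le> ?K * ?r powr - s"
    using l lo by (intro powr_le_of_comparable) auto
  have "norm (f x - f y) \<le> norm (f x - c J) + norm (f y - c J)"
    by norm
  then have "(norm (f x - f y))\<^sup>2 \<le> (norm (f x - c J) + norm (f y - c J))\<^sup>2"
    by (intro power_mono) auto
  also have "\<dots> \<le> 2 * ((norm (f x - c J))\<^sup>2 + (norm (f y - c J))\<^sup>2)"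
    using zero_le_power2[of "norm (f x - c J) - norm (f y - c J)"]
    by (simp add: power2_sum power2_diff)
  finally have "(norm (f x - f y))\<^sup>2 * (1 / norm (x - y) powr s)
      \<le> 2 * ((norm (f x - c J))\<^sup>2 + (norm (f y - c J))\<^sup>2) * (?K * ?r powr - s)"
    using ker by (intro mult_mono) auto
  then have "ennreal ((norm (f x - f y))\<^sup>2 / norm (x - y) powr s)
      \<le> ennreal ((?K * ?r powr - s) * (2 * ((norm (f x - c J))\<^sup>2 + (norm (f y - c J))\<^sup>2)))"
    by (intro ennreal_leI) (simp add: mult.commute)
  also have "\<dots> = ?g k J"
    using xJ yJ by (subst ennreal_mult'') (simp_all add: ennreal_mult ennreal_plus)
  \<comment> \<open>All terms are nonnegative, so this one is enlarged to the sum over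
    \<open>J\<close>, then over \<open>k\<close>, then over \<open>v\<close>.\<close>
  also have "\<dots> \<le> (\<Sum>J\<in>dyadic k (shifted_double a l v). ?g k J)"
    using J l by (intro member_le_sum finite_dyadic) (auto simp: shifted_double_in_cubes)
  also have "\<dots> \<le> (\<Sum>k. \<Sum>J\<in>dyadic k (shifted_double a l v). ?g k J)"
    using sum_le_suminf[of "\<lambda>k. \<Sum>J\<in>dyadic k (shifted_double a l v). ?g k J" "{k}"] by simp
  also have "\<dots> \<le> (\<Sum>v\<in>lattice_points 2. \<Sum>k. \<Sum>J\<in>dyadic k (shifted_double a l v). ?g k J)"
    using v card_lattice_points[of 2, where 'n = 'n]
    by (intro member_le_sum) (auto intro: card_ge_0_finite)
  finally show ?thesis .
qed simp

text \<open>Separated from the double integral because this explicit form also shows that the inner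
  integral is measurable in \<open>y\<close>.\<close>

lemma nn_integral_pair_sum_inner:
  assumes [measurable]: "h \<in> borel_measurable M" "J \<in> sets M"
  shows "(\<integral>\<^sup>+ x. 2 * (h x + h y) * indicator J x * indicator J y \<partial>M)
    = 2 * (\<integral>\<^sup>+ x\<in>J. h x \<partial>M) * indicator J y + 2 * emeasure M J * (h y * indicator J y)"
proof -
  have "(\<integral>\<^sup>+ x. 2 * (h x + h y) * indicator J x * indicator J y \<partial>M)
     = (\<integral>\<^sup>+ x. (2 * indicator J y) * (h x * indicator J x) + (2 * h y * indicator J y) * indicator J x \<partial>M)"
    by (intro nn_integral_cong) (simp add: distrib_left distrib_right mult_ac)
  also have "\<dots> = 2 * indicator J y * (\<integral>\<^sup>+ x\<in>J. h x \<partial>M) + 2 * h y * indicator J y * emeasure M J"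
    by (simp add: nn_integral_add nn_integral_cmult)
  finally show ?thesis
    by (simp add: mult_ac)
qed

lemma nn_integral_pair_sum:
  assumes [measurable]: "h \<in> borel_measurable M" "J \<in> sets M"
  shows "(\<integral>\<^sup>+ y. (\<integral>\<^sup>+ x. 2 * (h x + h y) * indicator J x * indicator J y \<partial>M) \<partial>M)
    = 4 * emeasure M J * (\<integral>\<^sup>+ x\<in>J. h x \<partial>M)"
proof -
  let ?E = "\<integral>\<^sup>+ x\<in>J. h x \<partial>M"
  have "(\<integral>\<^sup>+ y. (\<integral>\<^sup>+ x. 2 * (h x + h y) * indicator J x * indicator J y \<partial>M) \<partial>M)
      = (\<integral>\<^sup>+ y. 2 * ?E * indicator J y + 2 * emeasure M J * (h y * indicator J y) \<partial>M)"
    by (simp only: nn_integral_pair_sum_inner[OF assms])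
  also have "\<dots> = 2 * ?E * emeasure M J + 2 * emeasure M J * ?E"
    by (simp add: nn_integral_add nn_integral_cmult)
  also have "\<dots> = 2 * (emeasure M J * ?E) + 2 * (emeasure M J * ?E)"
    by (simp add: mult_ac)
  also have "\<dots> = (2 + 2) * (emeasure M J * ?E)"
    by (rule distrib_right[symmetric])
  finally show ?thesis
    by (simp add: mult.assoc)
qed

lemma dyadic_cubeE:
  assumes "J \<in> dyadic k (cube a l)" "l > 0"
  obtains b where "J = cube b (l / 2 ^ k)"
  using assms by (auto simp: dyadic_cube)

text \<open>Termwise integration of the kernel bound leaves each oscillation with the square of the
  measure of \<open>J\<close>: one factor from the free variable, one from undoing the
  normalisation. With \<open>r = 2 * l / 2 ^ k\<close> and \<open>n = CARD('n)\<close>, the total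
  power of \<open>r\<close> is \<open>n - 2 * \<gamma>\<close>, which splits into the prefactor and
  the dyadic weight.\<close>

lemma Q_integral_le_dyadic_sum:
  fixes f :: "real ^ 'n \<Rightarrow> complex"
  assumes [measurable]: "f \<in> borel_measurable lebesgue" and l: "l > 0"
  shows "(\<integral>\<^sup>+ y\<in>cube a l. (\<integral>\<^sup>+ x\<in>cube a l. ennreal ((norm (f x - f y))\<^sup>2 /
            norm (x - y) powr (real CARD('n) + 2 * \<gamma>)) \<partial>lebesgue) \<partial>lebesgue)
    \<le> ennreal (4 * ((1 / 6) powr - (real CARD('n) + 2 * \<gamma>) + CARD('n) powr - (real CARD('n) + 2 * \<gamma>))
         * (2 * l) powr (real CARD('n) - 2 * \<gamma>)) *
       (\<Sum>v\<in>lattice_points 2. \<Sum>k. ennreal (2 powr ((2 * \<gamma> - real CARD('n)) * real k)) *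
          (\<Sum>J\<in>dyadic k (shifted_double a l v). mean_square_osc f J))"
proof -
  define s where "s = real CARD('n) + 2 * \<gamma>"
  define K where "K = (1 / 6) powr - s + CARD('n) powr - s"
  have K: "K \<ge> 0"
    by (simp add: K_def)
  define w where "w k = ennreal (K * (2 * l / 2 ^ k) powr - s)" for k :: nat
  define h where "h J x = ennreal ((norm (f x - mean f J))\<^sup>2)" for J x
  define g where "g J x y = 2 * (h J x + h J y) * indicator J x * indicator J y" for J x y
  let ?V = "lattice_points 2 :: (real ^ 'n) set" and ?D = "\<lambda>k v. dyadic k (shifted_double a l v)"
  have cubes: "shifted_double a l v \<in> cubes" for v
    using l by (rule shifted_double_in_cubes)
  have J [measurable]: "J \<in> sets lebesgue" if "J \<in> ?D k v" for J k v
    using that dyadic_subset_cubes[OF cubes, of k v] by (auto simp: sets_cubes)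
  have h [measurable]: "h J \<in> borel_measurable lebesgue" for J
    unfolding h_def by measurable
  have gx: "(\<lambda>x. g J x y) \<in> borel_measurable lebesgue" if "J \<in> ?D k v" for J k v y
    using J[OF that] unfolding g_def by measurable
  have gy: "(\<lambda>y. \<integral>\<^sup>+ x. g J x y \<partial>lebesgue) \<in> borel_measurable lebesgue" if "J \<in> ?D k v" for J k v
    using J[OF that] unfolding g_def nn_integral_pair_sum_inner[OF h J[OF that]] by measurable
  have "(\<integral>\<^sup>+ y\<in>cube a l. (\<integral>\<^sup>+ x\<in>cube a l. ennreal ((norm (f x - f y))\<^sup>2 / norm (x - y) powr s) \<partial>lebesgue) \<partial>lebesgue)
      \<le> (\<integral>\<^sup>+ y. (\<integral>\<^sup>+ x. (\<Sum>v\<in>?V. \<Sum>k. \<Sum>J\<in>?D k v. w k * g J x y) \<partial>lebesgue) \<partial>lebesgue)"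
  proof (intro nn_integral_mono)
    fix y
    show "(\<integral>\<^sup>+ x\<in>cube a l. ennreal ((norm (f x - f y))\<^sup>2 / norm (x - y) powr s) \<partial>lebesgue) * indicator (cube a l) y
        \<le> (\<integral>\<^sup>+ x. (\<Sum>v\<in>?V. \<Sum>k. \<Sum>J\<in>?D k v. w k * g J x y) \<partial>lebesgue)"
    proof (cases "y \<in> cube a l")
      case True
      \<comment> \<open>The kernel bound is available on \<open>cube a l\<close>; elsewhere the
        indicator makes the left side vanish, so the right side may be integrated over the whole
        space.\<close>
      then have "ennreal ((norm (f x - f y))\<^sup>2 / norm (x - y) powr s) * indicator (cube a l) x
          \<le> (\<Sum>v\<in>?V. \<Sum>k. \<Sum>J\<in>?D k v. w k * g J x y)" for x
        using kernel_le_dyadic_sum[OF l, of x a y f s "mean f"]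
        by (cases "x \<in> cube a l") (simp_all add: w_def K_def g_def h_def)
      then show ?thesis
        using True by (auto intro: nn_integral_mono)
    qed simp
  qed
  also have "\<dots> = (\<integral>\<^sup>+ y. (\<Sum>v\<in>?V. \<Sum>k. \<Sum>J\<in>?D k v. w k * (\<integral>\<^sup>+ x. g J x y \<partial>lebesgue)) \<partial>lebesgue)"
    using gx by (simp add: nn_integral_sum nn_integral_suminf nn_integral_cmult cong: sum.cong)
  also have "\<dots> = (\<Sum>v\<in>?V. \<Sum>k. \<Sum>J\<in>?D k v. w k * (\<integral>\<^sup>+ y. (\<integral>\<^sup>+ x. g J x y \<partial>lebesgue) \<partial>lebesgue))"
    using gy by (simp add: nn_integral_sum nn_integral_suminf nn_integral_cmult cong: sum.cong)
  also have "\<dots> = (\<Sum>v\<in>?V. \<Sum>k. \<Sum>J\<in>?D k v. ennreal (4 * K * (2 * l) powr (real CARD('n) - 2 * \<gamma>)) *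
        (ennreal (2 powr ((2 * \<gamma> - real CARD('n)) * real k)) * mean_square_osc f J))"
  proof (intro sum.cong suminf_cong refl)
    fix v k J assume JD: "J \<in> ?D k v"
    let ?r = "2 * l / 2 ^ k"
    have r: "?r > 0" using l by simp
    obtain b where b: "J = cube b ?r"
      using JD l by (auto simp: shifted_double_def elim: dyadic_cubeE)
    have eJ: "emeasure lebesgue J = ennreal (?r ^ CARD('n))"
      unfolding b by (rule emeasure_cube[OF r])
    let ?E = "\<integral>\<^sup>+ x\<in>J. h J x \<partial>lebesgue"
    \<comment> \<open>Division by the measure of \<open>J\<close> can be undone because that measure
      is positive and finite.\<close>
    have osc: "?E = emeasure lebesgue J * mean_square_osc f J"
    proof -
      have "emeasure lebesgue J \<noteq> 0" "emeasure lebesgue J \<noteq> top"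
        using r unfolding eJ by auto
      then show ?thesis
        unfolding mean_square_osc_def h_def ennreal_times_divide
        by (subst mult.commute) (simp only: mult_divide_eq_ennreal not_False_eq_True)
    qed
    have "w k * (\<integral>\<^sup>+ y. (\<integral>\<^sup>+ x. g J x y \<partial>lebesgue) \<partial>lebesgue)
        = w k * (4 * emeasure lebesgue J * (emeasure lebesgue J * mean_square_osc f J))"
      using J[OF JD] unfolding g_def by (subst nn_integral_pair_sum) (simp_all add: osc)
    also have "\<dots> = (w k * 4 * ennreal (?r ^ CARD('n)) * ennreal (?r ^ CARD('n))) * mean_square_osc f J"
      by (simp add: eJ mult_ac)
    also have "w k * 4 * ennreal (?r ^ CARD('n)) * ennreal (?r ^ CARD('n))
        = ennreal (K * ?r powr - s * 4 * ?r ^ CARD('n) * ?r ^ CARD('n))"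
      using K r by (simp add: w_def ennreal_mult)
    also have "K * ?r powr - s * 4 * ?r ^ CARD('n) * ?r ^ CARD('n)
        = 4 * K * ?r powr (real CARD('n) - 2 * \<gamma>)"
    proof -
      have "?r powr (real CARD('n) - 2 * \<gamma>) = ?r powr (- s + real CARD('n) + real CARD('n))"
        by (simp add: s_def)
      also have "\<dots> = ?r powr - s * ?r ^ CARD('n) * ?r ^ CARD('n)"
        using r by (simp only: powr_add powr_realpow)
      finally show ?thesis by simp
    qed
    also have "?r powr (real CARD('n) - 2 * \<gamma>)
        = (2 * l) powr (real CARD('n) - 2 * \<gamma>) * 2 powr ((2 * \<gamma> - real CARD('n)) * real k)"
    proof -
      have "(2::real) ^ k = 2 powr real k"
        by (simp add: powr_realpow)
      then have "?r = 2 * l * 2 powr - real k"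
        by (simp add: powr_minus_divide)
      then have "?r powr (real CARD('n) - 2 * \<gamma>)
          = (2 * l) powr (real CARD('n) - 2 * \<gamma>) * (2 powr - real k) powr (real CARD('n) - 2 * \<gamma>)"
        using l by (simp add: powr_mult)
      then show ?thesis
        by (simp add: powr_powr algebra_simps)
    qed
    finally show "w k * (\<integral>\<^sup>+ y. (\<integral>\<^sup>+ x. g J x y \<partial>lebesgue) \<partial>lebesgue)
        = ennreal (4 * K * (2 * l) powr (real CARD('n) - 2 * \<gamma>)) *
          (ennreal (2 powr ((2 * \<gamma> - real CARD('n)) * real k)) * mean_square_osc f J)"
      using K by (simp add: ennreal_mult mult_ac)
  qed
  also have "\<dots> = ennreal (4 * K * (2 * l) powr (real CARD('n) - 2 * \<gamma>)) *
      (\<Sum>v\<in>?V. \<Sum>k. ennreal (2 powr ((2 * \<gamma> - real CARD('n)) * real k)) * (\<Sum>J\<in>?D k v. mean_square_osc f J))"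
    by (simp only: sum_distrib_left[symmetric] ennreal_suminf_cmult)
  finally show ?thesis
    by (simp add: K_def s_def)
qed

section \<open>Measurability and the final norm estimate\<close>

lemma locally_integrable_borel_measurable:
  fixes f :: "real ^ 'n \<Rightarrow> complex"
  assumes "locally_integrable f"
  shows "f \<in> borel_measurable lebesgue"
\<comment> \<open>Truncations to growing balls are integrable, hence measurable, and at every point
  they eventually equal \<open>f\<close>.\<close>
proof (rule borel_measurable_LIMSEQ_metric)
  fix i :: nat
  have "f absolutely_integrable_on cball 0 (real i)"
    using assms by (simp add: locally_integrable_def)
  then show "(\<lambda>x. indicator (cball 0 (real i)) x *\<^sub>R f x) \<in> borel_measurable lebesgue"
    unfolding set_integrable_def by (rule borel_measurable_integrable)
next
  fix x :: "real ^ 'n"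
  obtain n :: nat where n: "norm x \<le> real n"
    using real_arch_simple by blast
  have "\<forall>\<^sub>F i in sequentially. indicator (cball 0 (real i)) x *\<^sub>R f x = f x"
    using eventually_ge_at_top[of n] by eventually_elim (use n in auto)
  then show "(\<lambda>i. indicator (cball 0 (real i)) x *\<^sub>R f x) \<longlonglongrightarrow> f x"
    by (rule tendsto_eventually)
qed

text \<open>Finiteness of \<open>y\<close> enters because \<open>enn2real\<close> sends
  \<open>\<infinity>\<close> to \<open>0\<close> and is monotone only below it.\<close>

lemma sqrt_ennreal_mono:
  assumes "x \<le> y" "y < \<infinity>"
  shows "sqrt_ennreal x \<le> sqrt_ennreal y"
  using assms by (auto simp: sqrt_ennreal_def enn2real_mono intro!: ennreal_leI)

theorem theorem1p2:
  fixes f :: "real ^ 'n \<Rightarrow> complex" and \<alpha> \<beta> p :: real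
  assumes "CARD('n) \<ge> 2"
    and "\<alpha> < \<beta>" and "\<beta> \<in> {1/2<..1}"
    and "0 \<le> p" and "p < 2"
    and "locally_integrable f"
    and "\<exists>B C c :: real. B > 0 \<and> C > 0 \<and> c > 0 \<and>
      (\<forall>I\<in>cubes. \<forall>t>0.
        ennreal (edge_length I powr (4 * \<beta> - 4)) *
          (\<Sum>k. ennreal (2 powr ((2 * (\<alpha> - \<beta> + 1) - real CARD('n)) * real k)) *
             (\<Sum>J\<in>dyadic k I. distr_fun f J t / emeasure lebesgue J))
        \<le> ennreal (B * max 1 ((C / t) powr p) * exp (- c * t)))"
  shows "f \<in> Q_space \<alpha> \<beta>"
proof -
  define \<gamma> where "\<gamma> = \<alpha> - \<beta> + 1"
  let ?n = "real CARD('n)"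
  obtain B C c :: real where BCc: "B > 0" "C > 0" "c > 0" and
    decay: "\<And>I t. I \<in> cubes \<Longrightarrow> t > 0 \<Longrightarrow> ennreal (edge_length I powr (4 * \<beta> - 4)) *
          (\<Sum>k. ennreal (2 powr ((2 * \<gamma> - ?n) * real k)) *
             (\<Sum>J\<in>dyadic k I. distr_fun f J t / emeasure lebesgue J))
        \<le> ennreal (B * max 1 ((C / t) powr p) * exp (- c * t))"
    using assms(7) unfolding \<gamma>_def by blast
  have f [measurable]: "f \<in> borel_measurable lebesgue"
    by (rule locally_integrable_borel_measurable) fact
  \<comment> \<open>One number serves all cubes: the right-hand side of the hypothesis does not
    depend on \<open>I\<close>, which makes the final bound uniform.\<close>
  define M where
    "M = (\<integral>\<^sup>+ t\<in>{0<..}. ennreal (2 * t * (B * max 1 ((C / t) powr p) * exp (- c * t))) \<partial>lborel)"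
  have M: "M < \<infinity>"
    unfolding M_def using BCc assms by (intro nn_integral_weak_tail_finite)
  define \<Psi> where "\<Psi> I = (\<Sum>k. ennreal (2 powr ((2 * \<gamma> - ?n) * real k)) * (\<Sum>J\<in>dyadic k I. mean_square_osc f J))"
    for I
  have \<Psi>: "ennreal (edge_length I powr (4 * \<beta> - 4)) * \<Psi> I \<le> M" if "I \<in> cubes" for I
    unfolding \<Psi>_def M_def using that decay by (intro dyadic_osc_sum_le) auto
  define K where "K = 4 * ((1 / 6) powr - (?n + 2 * \<gamma>) + ?n powr - (?n + 2 * \<gamma>))"
  have K: "K \<ge> 0"
    by (simp add: K_def)
  \<comment> \<open>Collects the geometric constant and the cost of replacing \<open>l\<close> by
    \<open>2 * l\<close> in the power that precedes the double integral.\<close>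
  define \<kappa> where "\<kappa> = 2 powr (?n - 2 * (\<alpha> + \<beta> - 1)) * K"
  define R where "R = (\<Sum>v\<in>(lattice_points 2 :: (real ^ 'n) set). ennreal \<kappa> * M)"
  have R: "R < \<infinity>"
    using M by (simp add: R_def ennreal_mult_less_top ennreal_of_nat_eq_real_of_nat)
  have "ennreal (edge_length I powr (2 * (\<alpha> + \<beta> - 1) - ?n)) *
     (\<integral>\<^sup>+ y\<in>I. (\<integral>\<^sup>+ x\<in>I. ennreal ((norm (f x - f y))\<^sup>2 /
        norm (x - y) powr (?n + 2 * (\<alpha> - \<beta> + 1))) \<partial>lebesgue) \<partial>lebesgue) \<le> R" (is "?L \<le> R")
    if "I \<in> cubes" for I :: "(real ^ 'n) set"
  proof -
    obtain a l where I: "I = cube a l" and l: "l > 0"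
      using \<open>I \<in> cubes\<close> unfolding cubes_def by blast
    \<comment> \<open>The exponents \<open>2 * (\<alpha> + \<beta> - 1) - ?n\<close> and
      \<open>?n - 2 * \<gamma>\<close> add up to \<open>4 * \<beta> - 4\<close>, the power of the
      edge length in the hypothesis.\<close>
    have powers: "l powr (2 * (\<alpha> + \<beta> - 1) - ?n) * (K * (2 * l) powr (?n - 2 * \<gamma>))
        = \<kappa> * (2 * l) powr (4 * \<beta> - 4)"
    proof -
      have "(2 * l) powr (4 * \<beta> - 4) = (2 * l) powr (2 * (\<alpha> + \<beta> - 1) - ?n) * (2 * l) powr (?n - 2 * \<gamma>)"
        unfolding powr_add[symmetric] by (simp add: \<gamma>_def algebra_simps)
      also have "(2 * l) powr (2 * (\<alpha> + \<beta> - 1) - ?n)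
          = 2 powr (2 * (\<alpha> + \<beta> - 1) - ?n) * l powr (2 * (\<alpha> + \<beta> - 1) - ?n)"
        using l by (simp add: powr_mult)
      finally have "\<kappa> * (2 * l) powr (4 * \<beta> - 4)
          = (2 powr (?n - 2 * (\<alpha> + \<beta> - 1)) * 2 powr (2 * (\<alpha> + \<beta> - 1) - ?n)) *
            (l powr (2 * (\<alpha> + \<beta> - 1) - ?n) * (K * (2 * l) powr (?n - 2 * \<gamma>)))"
        by (simp add: \<kappa>_def mult_ac)
      also have "(2::real) powr (?n - 2 * (\<alpha> + \<beta> - 1)) * 2 powr (2 * (\<alpha> + \<beta> - 1) - ?n) = 1"
        unfolding powr_add[symmetric] by simp
      finally show ?thesis by simp
    qed
    have "?L \<le> ennreal (l powr (2 * (\<alpha> + \<beta> - 1) - ?n)) *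
        (ennreal (K * (2 * l) powr (?n - 2 * \<gamma>)) * (\<Sum>v\<in>lattice_points 2. \<Psi> (shifted_double a l v)))"
      unfolding I edge_length_cube[OF l] K_def \<Psi>_def \<gamma>_def[symmetric]
      by (rule mult_left_mono[OF Q_integral_le_dyadic_sum[OF f l]]) simp
    also have "\<dots> = ennreal (\<kappa> * (2 * l) powr (4 * \<beta> - 4)) * (\<Sum>v\<in>lattice_points 2. \<Psi> (shifted_double a l v))"
      using K by (simp add: powers[symmetric] ennreal_mult mult.assoc)
    also have "\<dots> = (\<Sum>v\<in>lattice_points 2. ennreal \<kappa> * (ennreal ((2 * l) powr (4 * \<beta> - 4)) * \<Psi> (shifted_double a l v)))"
      using K by (simp add: sum_distrib_left ennreal_mult \<kappa>_def mult.assoc)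
    also have "\<dots> \<le> R"
      unfolding R_def
    proof (intro sum_mono mult_left_mono)
      \<comment> \<open>The decay hypothesis is used for the shifted cube, whose edge
        \<open>2 * l\<close> is the base of the power obtained above.\<close>
      fix v :: "real ^ 'n"
      have "shifted_double a l v \<in> cubes" "edge_length (shifted_double a l v) = 2 * l"
        using l by (simp_all add: shifted_double_in_cubes) (simp add: shifted_double_def edge_length_cube)
      then show "ennreal ((2 * l) powr (4 * \<beta> - 4)) * \<Psi> (shifted_double a l v) \<le> M"
        using \<Psi> by metis
    qed simp
    finally show ?thesis .
  qed
  then have "Q_norm \<alpha> \<beta> f \<le> sqrt_ennreal R"
    unfolding Q_norm_def using R by (intro SUP_least sqrt_ennreal_mono) auto
  also have "\<dots> < \<infinity>"
    using R by (simp add: sqrt_ennreal_def)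
  finally show ?thesis
    using f by (simp add: Q_space_def)
qed

end
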